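(* Let $T$ be a tree, let $S\subset T$ be uncountable and $\omega_1$-compact in the subspace topology, and let $X$ be a locally metrizable space. Then there is no continuous $h\colon S\times[0,1]\to X$ such that $h(\cdot,1)\colon S\to X$ has uncountable image and $h(\cdot,0)$ is constant. In particular, if $X$ contains a copy of $S$ (a subspace homeomorphic to $S$), then $X$ is not contractible.
   Context: All topological spaces are Hausdorff. A tree $T$ is a partially ordered set such that the set of predecessors of each point is well ordered; trees are assumed to be Hausdorff (if $x,y\in T$ are at a limit level and have the same predecessors, then $x=y$) and are endowed with the order (interval) topology. A space is $\omega_1$-compact iff each of its closed discrete subsets is at most countable. A space $X$ is contractible if there is a continuous $h\colon X\times[0,1]\to X$ with $h(x,1)=x$ for all $x$ and $h(\cdot,0)$ constant. *)

theory Defs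
  imports "HOL-Analysis.Analysis"
begin

definition at_limit_level :: "'a rel \<Rightarrow> 'a \<Rightarrow> bool" where
  "at_limit_level r x \<longleftrightarrow>
     underS r x \<noteq> {} \<and> (\<forall>y\<in>underS r x. \<exists>z\<in>underS r x. y \<in> underS r z)"

text \<open>
  The pair \<open>(T, r)\<close> is a tree whose (reflexive) order is \<open>r\<close>. Several minimal elements are allowed:
  level 0 does not count as a limit level. The last conjunct is the Hausdorff condition on trees;
  points with the same predecessors automatically lie at the same level.
\<close>

definition hausdorff_tree :: "'a set \<Rightarrow> 'a rel \<Rightarrow> bool" where
  "hausdorff_tree T r \<longleftrightarrow>
     partial_order_on T r \<and>
     (\<forall>x\<in>T. well_order_on (underS r x) (Restr r (underS r x))) \<and>
     (\<forall>x\<in>T. \<forall>y\<in>T. at_limit_level r x \<and> at_limit_level r y \<and> underS r x = underS r y \<longrightarrow> x = y)"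

text \<open>
  The interval topology: a base is formed by the half-open intervals \<open>(s, t]\<close> together with
  the singletons of the minimal elements.
\<close>

definition tree_topology :: "'a set \<Rightarrow> 'a rel \<Rightarrow> 'a topology" where
  "tree_topology T r = topology_generated_by
     ({{x \<in> T. s \<in> underS r x \<and> (x, t) \<in> r} |s t. s \<in> T \<and> t \<in> T} \<union>
      {{t} |t. t \<in> T \<and> underS r t = {}})"

definition omega1_compact_space :: "'a topology \<Rightarrow> bool" where
  "omega1_compact_space X \<longleftrightarrow>
     (\<forall>C. closedin X C \<and> subtopology X C = discrete_topology C \<longrightarrow> countable C)"

definition locally_metrizable_space :: "'a topology \<Rightarrow> bool" where
  "locally_metrizable_space X \<longleftrightarrow>
     (\<forall>x\<in>topspace X. \<exists>U. openin X U \<and> x \<in> U \<and> metrizable_space (subtopology X U))"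

text \<open>
  Sanity checks: the tree topology lives on all of \<open>T\<close>, and the library notion
  \<^const>\<open>contractible_space\<close> (which has the time parameter first and running backwards) agrees
  with contractions \<open>h : X \<times> [0,1] \<rightarrow> X\<close> such that \<open>h(\<cdot>,1)\<close> is the identity
  and \<open>h(\<cdot>,0)\<close> is constant.
\<close>

lemma topspace_tree_topology:
  assumes "hausdorff_tree T r"
  shows "topspace (tree_topology T r) = T"
proof -
  let ?B = "{{x \<in> T. s \<in> underS r x \<and> (x, t) \<in> r} |s t. s \<in> T \<and> t \<in> T} \<union>
      {{t} |t. t \<in> T \<and> underS r t = {}}"
  have r: "r \<subseteq> T \<times> T" "\<forall>x\<in>T. (x, x) \<in> r"
    using assms by (auto simp: hausdorff_tree_def partial_order_on_def preorder_on_def refl_on_def)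
  have "x \<in> \<Union>?B" if "x \<in> T" for x
  proof (cases "underS r x = {}")
    case True
    with that have "{x} \<in> ?B" by blast
    then show ?thesis by blast
  next
    case False
    then obtain s where s: "s \<in> underS r x" by blast
    then have "s \<in> T" using r(1) by (auto simp: underS_def)
    with that have B: "{y \<in> T. s \<in> underS r y \<and> (y, x) \<in> r} \<in> ?B" by blast
    have "x \<in> {y \<in> T. s \<in> underS r y \<and> (y, x) \<in> r}"
      using s that r(2) by blast
    with B show ?thesis by (rule UnionI)
  qed
  then have "T \<subseteq> \<Union>?B" by (rule subsetI)
  moreover have "\<Union>?B \<subseteq> T" by blast
  ultimately have "\<Union>?B = T" by (rule equalityI[rotated])
  then show ?thesis
    unfolding tree_topology_def topology_generated_by_topspace .
qed

lemma contractible_space_iff_contraction: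
  "contractible_space X \<longleftrightarrow>
     (\<exists>h. continuous_map (prod_topology X (top_of_set {0..1::real})) X h \<and>
          (\<forall>x\<in>topspace X. h (x, 1) = x) \<and> (\<lambda>x. h (x, 0)) constant_on topspace X)"
    (is "?L \<longleftrightarrow> ?R")
proof -
  let ?I = "top_of_set {0..1::real}"
  have flip: "continuous_map ?I ?I (\<lambda>t. 1 - t)"
    by (auto intro!: continuous_intros)
  let ?s = "\<lambda>(x, t::real). (1 - t, x)" and ?s' = "\<lambda>(t::real, x). (x, 1 - t)"
  have s: "continuous_map (prod_topology X ?I) (prod_topology ?I X) ?s"
    unfolding case_prod_beta
    by (intro continuous_map_pairedI continuous_map_fst
        continuous_map_compose[OF continuous_map_snd flip, unfolded comp_def])
  have s': "continuous_map (prod_topology ?I X) (prod_topology X ?I) ?s'"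
    unfolding case_prod_beta
    by (intro continuous_map_pairedI continuous_map_snd
        continuous_map_compose[OF continuous_map_fst flip, unfolded comp_def])
  have "?R" if L: ?L
  proof -
    obtain a k where k: "continuous_map (prod_topology ?I X) X k"
        "\<forall>x. k (0, x) = x" "\<forall>x. k (1, x) = a"
      using L unfolding contractible_space_def homotopic_with_def by auto
    have "continuous_map (prod_topology X ?I) X (k \<circ> ?s)"
      using continuous_map_compose[OF s k(1)] .
    with k(2,3) show ?R
      unfolding constant_on_def by (intro exI[of _ "k \<circ> ?s"] conjI exI[of _ a]) simp_all
  qed
  moreover have "?L" if R: ?R
  proof -
    obtain h a where h: "continuous_map (prod_topology X ?I) X h"
        "\<forall>x\<in>topspace X. h (x, 1) = x" "\<forall>x\<in>topspace X. h (x, 0) = a"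
      using R unfolding constant_on_def by blast
    have "continuous_map (prod_topology ?I X) X (h \<circ> ?s')"
      using continuous_map_compose[OF s' h(1)] .
    then have "homotopic_with (\<lambda>x. True) X X id (\<lambda>x. a)"
      using h(2,3) by (subst homotopic_with, simp) (intro exI[of _ "h \<circ> ?s'"], simp)
    then show ?L
      unfolding contractible_space_def by blast
  qed
  ultimately show ?thesis
    by blast
qed

end

theory Submission
  imports Defs
begin

text \<open>
  The engine is a greedy construction: given a relation \<open>J\<close> of ``jumps'', recursively collect the points
  that make a jump from the last collected point below them. If jumps cannot accumulate, the collected
  set is closed and discrete, hence countable, and above it no jumps occur. Thus real-valued monotone
  functions and continuous maps into metric spaces are constant, and upper semicontinuous functions
  into \<open>\<nat>\<close> are bounded, on the cone \<open>{y. z \<le> y}\<close> of every \<open>z\<close> outside the downward closure of some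
  countable set.

  Call \<open>x\<close> bad if \<open>h(\<cdot>, 1)\<close> has uncountable image on the cone of \<open>x\<close>. If initial segments have
  countable image, every bad point has bad points above it that avoid a given countably generated
  initial part. Let \<open>\<tau> x\<close> be the largest \<open>c\<close> such that \<open>h(\<cdot>, t)\<close> is constant on the cone
  of \<open>x\<close> for all \<open>t \<le> c\<close>. Above some bad point \<open>\<tau>\<close> is constant, say \<open>c\<close>. If \<open>c < 1\<close>, then over a
  higher cone \<open>h\<close> maps a time interval \<open>[c, b]\<close> with \<open>b > c\<close> into one metrizable open set, so over a
  still higher bad cone \<open>h(\<cdot>, t)\<close> is constant for rational \<open>t\<close> in that interval, hence for
  all \<open>t \<le> b\<close>, a contradiction. So \<open>c = 1\<close>, contradicting badness. If some initial segment has
  uncountable image, replace \<open>S\<close> by the points strictly below the first endpoint \<open>a\<close> of such a segment: \<open>a\<close>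
  is not a limit of them, as otherwise a countable neighbourhood base at \<open>h(a, 1)\<close> would make the
  image countable, so they form a closed subset of \<open>S\<close>.
\<close>

text \<open>The agreement set of continuous maps into a Hausdorff space is closed. This carries
  equalities of time paths to limits of times.\<close>

lemma continuous_maps_eq_on_closure:
  fixes g k :: "real \<Rightarrow> 'b"
  assumes "Hausdorff_space X" "continuous_map (top_of_set {0..1}) X g" "continuous_map (top_of_set {0..1}) X k"
    and R: "R \<subseteq> {0..1}" "\<And>t. t \<in> R \<Longrightarrow> g t = k t" and u: "u \<in> closure R"
  shows "g u = k u"
proof -
  have "closedin (top_of_set {0..1}) {t \<in> {0..1}. g t = k t}"
    using closedin_continuous_maps_eq[OF assms(1-3)] by simp
  then have "closed {t \<in> {0..1}. g t = k t}"
    by (rule closedin_closed_trans) simp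
  moreover have "R \<subseteq> {t \<in> {0..1}. g t = k t}" using R by auto
  ultimately have "closure R \<subseteq> {t \<in> {0..1}. g t = k t}" by (rule closure_minimal[rotated])
  with u show ?thesis by blast
qed

subsection \<open>Jumps along trees\<close>

text \<open>Well-foundedness and comparability of predecessors together encode well-ordered
  predecessor sets.\<close>

locale tree_order =
  fixes less :: "'a \<Rightarrow> 'a \<Rightarrow> bool" (infix "\<sqsubset>" 50)
  assumes trans: "x \<sqsubset> y \<Longrightarrow> y \<sqsubset> z \<Longrightarrow> x \<sqsubset> z"
    and linear: "x \<sqsubset> z \<Longrightarrow> y \<sqsubset> z \<Longrightarrow> x = y \<or> x \<sqsubset> y \<or> y \<sqsubset> x"
    and wf: "wf {(x, y). x \<sqsubset> y}"
begin

abbreviation lesseq (infix "\<sqsubseteq>" 50) where "x \<sqsubseteq> y \<equiv> x = y \<or> x \<sqsubset> y"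

abbreviation cone :: "'a set \<Rightarrow> 'a \<Rightarrow> 'a set" where "cone S z \<equiv> {y \<in> S. z \<sqsubseteq> y}"

text \<open>Vacuously true at minimal \<open>s\<close>, which are isolated in the interval topology.\<close>
definition eventually_below :: "'a set \<Rightarrow> 'a \<Rightarrow> ('a \<Rightarrow> bool) \<Rightarrow> bool" where
  "eventually_below S s P \<longleftrightarrow> (\<forall>v. v \<sqsubset> s \<longrightarrow> (\<exists>u. u \<sqsubset> s \<and> (\<forall>x\<in>S. u \<sqsubset> x \<longrightarrow> x \<sqsubset> s \<longrightarrow> P x)))"

text \<open>A set \<open>C \<subseteq> S\<close> is closed and discrete in \<open>S\<close> iff no point of \<open>S\<close> is a limit of points of
  \<open>C\<close> from below, so this is \<open>\<omega>\<^sub>1\<close>-compactness in terms of the order.\<close>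
definition omega1_tame :: "'a set \<Rightarrow> bool" where
  "omega1_tame S \<longleftrightarrow> (\<forall>C\<subseteq>S. (\<forall>s\<in>S. eventually_below C s (\<lambda>_. False)) \<longrightarrow> countable C)"

text \<open>The sequences need not increase; only consecutive terms are related by \<open>J\<close>.
  A greedy set accumulating at \<open>s\<close> would produce such a sequence.\<close>

definition jumps_finite_below :: "'a set \<Rightarrow> ('a \<Rightarrow> 'a \<Rightarrow> bool) \<Rightarrow> bool" where
  "jumps_finite_below S J \<longleftrightarrow> (\<forall>s\<in>S. \<forall>v. v \<sqsubset> s \<longrightarrow> (\<exists>u. u \<sqsubset> s \<and>
      (\<nexists>d :: nat \<Rightarrow> 'a. \<forall>k. d k \<in> S \<and> u \<sqsubset> d k \<and> d k \<sqsubset> s \<and> J (d k) (d (Suc k)))))"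

section \<open>Order and limits from below\<close>

lemma cone_cone: "z \<in> cone S x \<Longrightarrow> cone (cone S x) z = cone S z"
  using trans by auto

lemma irrefl: "\<not> x \<sqsubset> x"
  using wf_irrefl[OF wf] by blast

lemma minimal_element:
  assumes "x \<in> Q"
  shows "\<exists>m\<in>Q. \<forall>y. y \<sqsubset> m \<longrightarrow> y \<notin> Q"
  using wf assms unfolding wf_eq_minimal mem_Collect_eq case_prod_conv by metis

lemma eventually_belowD:
  assumes "eventually_below S s P" "v \<sqsubset> s"
  shows "\<exists>u. u \<sqsubset> s \<and> (\<forall>x\<in>S. u \<sqsubset> x \<longrightarrow> x \<sqsubset> s \<longrightarrow> P x)"
  using assms unfolding eventually_below_def by blast

lemma eventually_below_mono:
  assumes "eventually_below S s P" "S' \<subseteq> S" "\<And>x. x \<in> S' \<Longrightarrow> x \<sqsubset> s \<Longrightarrow> P x \<Longrightarrow> Q x"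
  shows "eventually_below S' s Q"
proof -
  have "\<exists>u. u \<sqsubset> s \<and> (\<forall>x\<in>S'. u \<sqsubset> x \<longrightarrow> x \<sqsubset> s \<longrightarrow> Q x)" if v: "v \<sqsubset> s" for v
  proof -
    obtain u where "u \<sqsubset> s" "\<forall>x\<in>S. u \<sqsubset> x \<longrightarrow> x \<sqsubset> s \<longrightarrow> P x"
      using assms(1) v unfolding eventually_below_def by blast
    then show ?thesis using assms(2,3) by (intro exI[of _ u]) auto
  qed
  then show ?thesis unfolding eventually_below_def by blast
qed

lemma eventually_below_conj:
  assumes "eventually_below S s P" "eventually_below S s Q"
  shows "eventually_below S s (\<lambda>x. P x \<and> Q x)"
  unfolding eventually_below_def
proof (intro allI impI)
  fix v assume v: "v \<sqsubset> s"
  obtain u where u: "u \<sqsubset> s" "\<forall>x\<in>S. u \<sqsubset> x \<longrightarrow> x \<sqsubset> s \<longrightarrow> P x"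
    using eventually_belowD[OF assms(1) v] by metis
  obtain w where w: "w \<sqsubset> s" "\<forall>x\<in>S. w \<sqsubset> x \<longrightarrow> x \<sqsubset> s \<longrightarrow> Q x"
    using eventually_belowD[OF assms(2) v] by metis
  obtain m where m: "m \<sqsubset> s" "u \<sqsubseteq> m" "w \<sqsubseteq> m"
    using linear[OF u(1) w(1)] u(1) w(1) by metis
  have "P x \<and> Q x" if "x \<in> S" "m \<sqsubset> x" "x \<sqsubset> s" for x
  proof -
    have "u \<sqsubset> x" "w \<sqsubset> x" using m(2,3) that(2) trans[of u m x] trans[of w m x] by metis+
    then show ?thesis using u(2) w(2) that(1,3) by blast
  qed
  then show "\<exists>u. u \<sqsubset> s \<and> (\<forall>x\<in>S. u \<sqsubset> x \<longrightarrow> x \<sqsubset> s \<longrightarrow> P x \<and> Q x)"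
    using m(1) by blast
qed

text \<open>The second hypothesis on \<open>K\<close> is closedness in \<open>S\<close>, so closed
  discrete subsets of \<open>K\<close> remain closed and discrete in \<open>S\<close>.\<close>

lemma omega1_tame_closed:
  assumes S: "omega1_tame S" and K: "K \<subseteq> S" "\<And>s. s \<in> S - K \<Longrightarrow> eventually_below K s (\<lambda>_. False)"
  shows "omega1_tame K"
  unfolding omega1_tame_def
proof (intro allI impI)
  fix C assume C: "C \<subseteq> K" and *: "\<forall>s\<in>K. eventually_below C s (\<lambda>_. False)"
  have "eventually_below C s (\<lambda>_. False)" if "s \<in> S" for s
  proof (cases "s \<in> K")
    case True with * show ?thesis by blast
  next
    case False
    with that have "eventually_below K s (\<lambda>_. False)" using K(2) by blast
    then show ?thesis by (rule eventually_below_mono[OF _ C])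
  qed
  with C K(1) show "countable C" using S unfolding omega1_tame_def by (meson subset_trans)
qed

lemma omega1_tame_cone:
  assumes "omega1_tame S"
  shows "omega1_tame (cone S z)"
proof (rule omega1_tame_closed[OF assms])
  fix s assume "s \<in> S - cone S z"
  then have "\<not> c \<sqsubset> s" if "c \<in> cone S z" for c
    using that trans by blast
  then show "eventually_below (cone S z) s (\<lambda>_. False)"
    unfolding eventually_below_def by blast
qed blast

section \<open>Greedy jump sets\<close>

text \<open>Membership depends only on members below, so well-founded recursion defines
  \<open>D\<close>. A point of \<open>S\<close> is rejected exactly when there is a last member
  below it from which it makes no jump; without a last member it is accepted.\<close>

lemma greedy_subset:
  fixes J :: "'a \<Rightarrow> 'a \<Rightarrow> bool"
  obtains D where "\<And>z. z \<in> D \<longleftrightarrow> z \<in> S \<and> \<not> (\<exists>d\<in>D. d \<sqsubset> z \<and> \<not> J d z \<and> (\<forall>e\<in>D. e \<sqsubset> z \<longrightarrow> e \<sqsubseteq> d))"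
proof -
  define F where "F P z \<longleftrightarrow> z \<in> S \<and>
      \<not> (\<exists>d. P d \<and> d \<sqsubset> z \<and> \<not> J d z \<and> (\<forall>e. P e \<longrightarrow> e \<sqsubset> z \<longrightarrow> e \<sqsubseteq> d))" for P z
  define P where "P = wfrec {(x, y). x \<sqsubset> y} F"
  have unfold: "P z = F P z" for z
  proof -
    have "P z = F (cut P {(x, y). x \<sqsubset> y} z) z"
      unfolding P_def by (rule wfrec[OF wf])
    also have "\<dots> = F P z"
    proof -
      \<comment> \<open>\<open>F\<close> consults its predicate only at points below
        \<open>z\<close>, where \<open>cut\<close> changes nothing.\<close>
      have "cut P {(x, y). x \<sqsubset> y} z x = P x" if "x \<sqsubset> z" for x
        using that by (simp add: cut_def)
      then show ?thesis unfolding F_def by metis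
    qed
    finally show ?thesis .
  qed
  have "z \<in> Collect P \<longleftrightarrow> z \<in> S \<and> \<not> (\<exists>d\<in>Collect P. d \<sqsubset> z \<and> \<not> J d z \<and> (\<forall>e\<in>Collect P. e \<sqsubset> z \<longrightarrow> e \<sqsubseteq> d))" for z
    using unfold[of z] unfolding F_def mem_Collect_eq Bex_def Ball_def by blast
  then show thesis by (rule that)
qed

text \<open>If \<open>D\<close> accumulated at \<open>s\<close> from below, moving repeatedly to the
  next member would give an infinite chain of jumps close to \<open>s\<close>. Hence
  \<open>D\<close> is closed and discrete in \<open>S\<close>, and tameness makes it
  countable.\<close>

lemma jump_set:
  fixes J :: "'a \<Rightarrow> 'a \<Rightarrow> bool"
  assumes S: "omega1_tame S"
    and J: "jumps_finite_below S J"
  obtains D where "D \<subseteq> S" "countable D"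
    "\<forall>z\<in>S. z \<in> D \<or> (\<exists>d\<in>D. d \<sqsubset> z \<and> \<not> J d z \<and> (\<forall>e\<in>D. e \<sqsubset> z \<longrightarrow> e \<sqsubseteq> d))"
proof -
  obtain D where D: "\<And>z. z \<in> D \<longleftrightarrow> z \<in> S \<and> \<not> (\<exists>d\<in>D. d \<sqsubset> z \<and> \<not> J d z \<and> (\<forall>e\<in>D. e \<sqsubset> z \<longrightarrow> e \<sqsubseteq> d))"
    using greedy_subset by metis
  then have DS: "D \<subseteq> S"
    and D_in: "\<And>z. z \<in> S \<Longrightarrow> z \<in> D \<or> (\<exists>d\<in>D. d \<sqsubset> z \<and> \<not> J d z \<and> (\<forall>e\<in>D. e \<sqsubset> z \<longrightarrow> e \<sqsubseteq> d))"
    and D_jump: "\<And>d z. z \<in> D \<Longrightarrow> d \<in> D \<Longrightarrow> d \<sqsubset> z \<Longrightarrow> \<forall>e\<in>D. e \<sqsubset> z \<longrightarrow> e \<sqsubseteq> d \<Longrightarrow> J d z"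
    by (metis subsetI)+
  have "\<exists>u. u \<sqsubset> s \<and> (\<forall>c\<in>D. u \<sqsubset> c \<longrightarrow> \<not> c \<sqsubset> s)" if s: "s \<in> S" "v \<sqsubset> s" for s v
  proof -
    obtain u where u: "u \<sqsubset> s"
      "\<nexists>d :: nat \<Rightarrow> 'a. \<forall>k. d k \<in> S \<and> u \<sqsubset> d k \<and> d k \<sqsubset> s \<and> J (d k) (d (Suc k))"
      using J s unfolding jumps_finite_below_def by blast
    define E where "E = {c \<in> D. u \<sqsubset> c \<and> c \<sqsubset> s}"
    show ?thesis
    proof (rule ccontr)
      assume neg: "\<not> ?thesis"
      \<comment> \<open>A minimal member \<open>e'\<close> above \<open>e\<close> and below
        \<open>s\<close> has \<open>e\<close> as its last predecessor in \<open>D\<close>, by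
        linearity; its acceptance then forces a jump.\<close>
      have next_ex: "\<exists>e'\<in>E. J e e'" if e: "e \<in> E" for e
      proof -
        have "e \<sqsubset> s" using e by (simp add: E_def)
        then obtain c where "c \<in> D" "e \<sqsubset> c" "c \<sqsubset> s" using neg by blast
        then have "c \<in> {c \<in> D. e \<sqsubset> c \<and> c \<sqsubset> s}" by blast
        from minimal_element[OF this] obtain e' where "e' \<in> {c \<in> D. e \<sqsubset> c \<and> c \<sqsubset> s}"
          and min: "\<forall>y. y \<sqsubset> e' \<longrightarrow> y \<notin> {c \<in> D. e \<sqsubset> c \<and> c \<sqsubset> s}"
          by (elim bexE) (rule that)
        then have e': "e' \<in> D" "e \<sqsubset> e'" "e' \<sqsubset> s" by simp_all
        have "x \<sqsubseteq> e" if "x \<in> D" "x \<sqsubset> e'" for x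
          using linear[OF that(2) e'(2)] min that(1,2) trans[OF that(2) e'(3)] by blast
        then have "J e e'" using D_jump[of e' e] e' e unfolding E_def by blast
        moreover have "e' \<in> E" using e e' trans[of u e e'] unfolding E_def by blast
        ultimately show ?thesis by blast
      qed
      obtain e0 where e0: "e0 \<in> E" using neg u unfolding E_def by blast
      obtain g where g: "\<And>e. e \<in> E \<Longrightarrow> g e \<in> E \<and> J e (g e)" using next_ex by metis
      define d where "d k = (g ^^ k) e0" for k
      have dE: "d k \<in> E" for k by (induction k) (auto simp: d_def e0 g)
      have "J (d k) (d (Suc k))" for k using g[OF dE, of k] by (simp add: d_def)
      moreover have "d k \<in> S \<and> u \<sqsubset> d k \<and> d k \<sqsubset> s" for k using dE[of k] DS by (auto simp: E_def)
      ultimately show False using u(2) by (meson exI)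
    qed
  qed
  then have "\<forall>s\<in>S. eventually_below D s (\<lambda>_. False)"
    unfolding eventually_below_def by metis
  then have "countable D" using S DS unfolding omega1_tame_def by metis
  then show thesis using that[of D] DS D_in by simp
qed

section \<open>Countably generated exceptional sets\<close>

text \<open>Exceptions lie in the downward closure of \<open>D\<close>. With
  \<open>D \<subseteq> S\<close>, bounds on initial segments ending in \<open>S\<close> apply to
  them.\<close>

definition almost_all :: "'a set \<Rightarrow> ('a \<Rightarrow> bool) \<Rightarrow> bool" where
  "almost_all S Q \<longleftrightarrow> (\<exists>D. D \<subseteq> S \<and> countable D \<and> (\<forall>z\<in>S. (\<forall>d\<in>D. \<not> z \<sqsubseteq> d) \<longrightarrow> Q z))"

lemma almost_all_mono:
  assumes "almost_all S Q" "\<And>z. z \<in> S \<Longrightarrow> Q z \<Longrightarrow> R z"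
  shows "almost_all S R"
proof -
  obtain D where "D \<subseteq> S" "countable D" "\<forall>z\<in>S. (\<forall>d\<in>D. \<not> z \<sqsubseteq> d) \<longrightarrow> Q z"
    using assms(1) unfolding almost_all_def by metis
  then show ?thesis
    unfolding almost_all_def using assms(2) by (intro exI[of _ D]) simp
qed

lemma almost_all_ball_countable:
  assumes "countable I" "\<And>i. i \<in> I \<Longrightarrow> almost_all S (Q i)"
  shows "almost_all S (\<lambda>z. \<forall>i\<in>I. Q i z)"
proof -
  obtain D where D: "\<And>i. i \<in> I \<Longrightarrow> D i \<subseteq> S \<and> countable (D i) \<and> (\<forall>z\<in>S. (\<forall>d\<in>D i. \<not> z \<sqsubseteq> d) \<longrightarrow> Q i z)"
    using assms(2) unfolding almost_all_def by metis
  show ?thesis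
    unfolding almost_all_def
  proof (rule exI[of _ "\<Union>i\<in>I. D i"], intro conjI)
    show "(\<Union>i\<in>I. D i) \<subseteq> S" "countable (\<Union>i\<in>I. D i)" using D assms(1) by auto
    show "\<forall>z\<in>S. (\<forall>d\<in>\<Union>i\<in>I. D i. \<not> z \<sqsubseteq> d) \<longrightarrow> (\<forall>i\<in>I. Q i z)"
    proof (intro ballI impI)
      fix z i assume "z \<in> S" "\<forall>d\<in>\<Union>i\<in>I. D i. \<not> z \<sqsubseteq> d" "i \<in> I"
      then show "Q i z" using D[of i] by simp
    qed
  qed
qed

text \<open>A point \<open>z\<close> outside the downward closure of the greedy set is rejected
  because of a last member \<open>d\<close> below it. No member lies at or above \<open>z\<close>,
  so the same \<open>d\<close> is the last member below, and the reason for rejecting, every point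
  of the cone.\<close>

lemma jump_cone:
  fixes J :: "'a \<Rightarrow> 'a \<Rightarrow> bool"
  assumes S: "omega1_tame S"
    and J: "jumps_finite_below S J"
  shows "almost_all S (\<lambda>z. \<exists>d\<in>S. d \<sqsubset> z \<and> (\<forall>y\<in>cone S z. \<not> J d y))"
proof -
  obtain D where D: "D \<subseteq> S" "countable D"
    "\<forall>z\<in>S. z \<in> D \<or> (\<exists>d\<in>D. d \<sqsubset> z \<and> \<not> J d z \<and> (\<forall>e\<in>D. e \<sqsubset> z \<longrightarrow> e \<sqsubseteq> d))"
    by (rule jump_set[OF assms])
  have "\<exists>d\<in>S. d \<sqsubset> z \<and> (\<forall>y\<in>cone S z. \<not> J d y)" if z: "z \<in> S" "\<forall>d\<in>D. \<not> z \<sqsubseteq> d" for z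
  proof -
    have "z \<notin> D" using z(2) by blast
    with D(3) z(1) obtain d where d: "d \<in> D" "d \<sqsubset> z" "\<forall>e\<in>D. e \<sqsubset> z \<longrightarrow> e \<sqsubseteq> d"
      by meson
    have "\<not> J d y" if y: "y \<in> S" "z \<sqsubseteq> y" for y
    proof -
      have "y \<notin> D" using y(2) z(2) by blast
      with D(3) y(1) obtain d' where d': "d' \<in> D" "d' \<sqsubset> y" "\<not> J d' y" "\<forall>e\<in>D. e \<sqsubset> y \<longrightarrow> e \<sqsubseteq> d'"
        by meson
      have "d' \<sqsubset> z" using linear[of d' y z] d'(1,2) y(2) z(2) by metis
      then have 1: "d' \<sqsubseteq> d" using d(3) d'(1) by metis
      have "d \<sqsubset> y" using d(2) trans[of d z y] y(2) by metis
      then have "d \<sqsubseteq> d'" using d'(4) d(1) by metis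
      with 1 have "d = d'" using irrefl[of d] trans[of d d' d] by metis
      then show ?thesis using d'(3) by simp
    qed
    then have "\<forall>y\<in>cone S z. \<not> J d y" by simp
    with d(1,2) D(1) show ?thesis by (intro bexI[of _ d] conjI) auto
  qed
  then show ?thesis
    unfolding almost_all_def using D(1,2) by (intro exI[of _ D] conjI) simp_all
qed

section \<open>Stabilization on cones\<close>

text \<open>A jump is a distance of at least \<open>1 / Suc n\<close>. Just below \<open>s\<close>
  all values are within half of that from \<open>f s\<close>, so not even one jump occurs there. The
  exceptional sets for all \<open>n\<close> are then combined.\<close>

lemma metric_constant_on_cones:
  assumes S: "omega1_tame S" and M: "Metric_space M d" and fM: "\<And>x. x \<in> S \<Longrightarrow> f x \<in> M"
    and cont: "\<And>s e. s \<in> S \<Longrightarrow> e > 0 \<Longrightarrow> eventually_below S s (\<lambda>x. d (f s) (f x) < e)"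
  shows "almost_all S (\<lambda>z. \<forall>y\<in>cone S z. f y = f z)"
proof -
  interpret Metric_space M d by (rule M)
  \<comment> \<open>The double negation matches \<open>jump_cone\<close> for a jump relation that is
    itself a negation.\<close>
  define Q where "Q n z \<longleftrightarrow> (\<exists>w\<in>S. w \<sqsubset> z \<and> (\<forall>y\<in>cone S z. \<not> \<not> d (f w) (f y) < 1 / Suc n))" for n z
  have "almost_all S (Q n)" for n
    unfolding Q_def
  proof (rule jump_cone[OF S])
    show "jumps_finite_below S (\<lambda>x y. \<not> d (f x) (f y) < 1 / Suc n)"
      unfolding jumps_finite_below_def
    proof (intro ballI allI impI)
      fix s v assume s: "s \<in> S" "v \<sqsubset> s"
      have "eventually_below S s (\<lambda>x. d (f s) (f x) < 1 / Suc n / 2)"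
        using cont[OF s(1)] by simp
      from eventually_belowD[OF this s(2)]
      obtain u where u: "u \<sqsubset> s" "\<forall>x\<in>S. u \<sqsubset> x \<longrightarrow> x \<sqsubset> s \<longrightarrow> d (f s) (f x) < 1 / Suc n / 2"
        by metis
      have "d (f x) (f y) < 1 / Suc n"
        if "x \<in> S" "u \<sqsubset> x" "x \<sqsubset> s" "y \<in> S" "u \<sqsubset> y" "y \<sqsubset> s" for x y
      proof -
        have "d (f x) (f y) \<le> d (f s) (f x) + d (f s) (f y)"
          using triangle''[of "f x" "f s" "f y"] fM that s by simp
        moreover have "d (f s) (f x) < 1 / Suc n / 2" "d (f s) (f y) < 1 / Suc n / 2"
          using u(2) that by simp_all
        ultimately show ?thesis by linarith
      qed
      then show "\<exists>u. u \<sqsubset> s \<and> (\<nexists>w :: nat \<Rightarrow> 'a. \<forall>k. w k \<in> S \<and> u \<sqsubset> w k \<and> w k \<sqsubset> s \<and>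
          \<not> d (f (w k)) (f (w (Suc k))) < 1 / Suc n)" using u(1) by (metis (no_types, lifting))
    qed
  qed
  then have "almost_all S (\<lambda>z. \<forall>n\<in>UNIV. Q n z)"
    by (intro almost_all_ball_countable) auto
  then show ?thesis
  proof (rule almost_all_mono, intro ballI)
    fix z y assume z: "z \<in> S" and Q: "\<forall>n\<in>UNIV. Q n z" and y: "y \<in> cone S z"
    have zz: "z \<in> cone S z" and yS: "y \<in> S" using z y by simp_all
    have *: "d (f y) (f z) < 2 / Suc n" for n
    proof -
      obtain w where w: "w \<in> S" "\<forall>y\<in>cone S z. d (f w) (f y) < 1 / Suc n"
        using Q unfolding Q_def by blast
      have "d (f y) (f z) \<le> d (f w) (f y) + d (f w) (f z)"
        using triangle''[of "f y" "f w" "f z"] fM w(1) yS z by simp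
      moreover have "d (f w) (f y) < 1 / Suc n" "d (f w) (f z) < 1 / Suc n"
        using w(2) y zz by blast+
      ultimately show ?thesis by simp
    qed
    have "d (f y) (f z) \<le> 0"
    proof (rule ccontr)
      assume "\<not> ?thesis"
      then obtain n where "inverse (real (Suc n)) < d (f y) (f z) / 2"
        using reals_Archimedean[of "d (f y) (f z) / 2"] by auto
      with *[of n] show False by (simp add: field_simps)
    qed
    with nonneg[of "f y" "f z"] have "d (f y) (f z) = 0" by linarith
    then show "f y = f z" using zero[OF fM[OF yS] fM[OF z]] by simp
  qed
qed

text \<open>A chain of jumps \<open>n x < n y\<close> just below \<open>s\<close> would take
  unbounded values, yet they are at most \<open>n s\<close>. The bound on a cone is the value of
  \<open>n\<close> at the point that \<open>jump_cone\<close> provides.\<close>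

lemma nat_bounded_on_cones:
  fixes n :: "'a \<Rightarrow> nat"
  assumes S: "omega1_tame S"
    and usc: "\<And>s. s \<in> S \<Longrightarrow> eventually_below S s (\<lambda>x. n x \<le> n s)"
  shows "almost_all S (\<lambda>z. \<exists>N. \<forall>y\<in>cone S z. n y \<le> N)"
proof -
  have "jumps_finite_below S (\<lambda>x y. n x < n y)"
    unfolding jumps_finite_below_def
  proof (intro ballI allI impI)
    fix s v assume s: "s \<in> S" "v \<sqsubset> s"
    obtain u where u: "u \<sqsubset> s" "\<forall>x\<in>S. u \<sqsubset> x \<longrightarrow> x \<sqsubset> s \<longrightarrow> n x \<le> n s"
      using eventually_belowD[OF usc[OF s(1)] s(2)] by metis
    have False if w: "\<forall>k. w k \<in> S \<and> u \<sqsubset> w k \<and> w k \<sqsubset> s \<and> n (w k) < n (w (Suc k))" for w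
    proof -
      have "k \<le> n (w k)" for k
      proof (induction k)
        case (Suc k)
        moreover have "n (w k) < n (w (Suc k))" using w by blast
        ultimately show ?case by linarith
      qed simp
      moreover have "n (w k) \<le> n s" for k using u(2) w by metis
      ultimately show False by (meson Suc_n_not_le_n order_trans)
    qed
    then show "\<exists>u. u \<sqsubset> s \<and> (\<nexists>w :: nat \<Rightarrow> 'a. \<forall>k. w k \<in> S \<and> u \<sqsubset> w k \<and> w k \<sqsubset> s \<and>
       n (w k) < n (w (Suc k)))" using u(1) by (metis (no_types, lifting))
  qed
  from jump_cone[OF S this] show ?thesis
    by (rule almost_all_mono) (metis not_less)
qed

text \<open>A jump is an increase by at least \<open>1 / Suc n\<close>, and the unit interval has
  room for finitely many. Monotonicity then gives \<open>g w \<le> g z\<close>, which squeezes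
  \<open>g\<close> on the cone.\<close>

lemma real_constant_on_cones:
  fixes g :: "'a \<Rightarrow> real"
  assumes S: "omega1_tame S" and mono: "\<And>x y. x \<in> S \<Longrightarrow> y \<in> S \<Longrightarrow> x \<sqsubset> y \<Longrightarrow> g x \<le> g y"
    and bdd: "\<And>x. x \<in> S \<Longrightarrow> 0 \<le> g x \<and> g x \<le> 1"
  shows "almost_all S (\<lambda>z. \<forall>y\<in>cone S z. g y = g z)"
proof -
  define Q where "Q n z \<longleftrightarrow> (\<exists>w\<in>S. w \<sqsubset> z \<and> (\<forall>y\<in>cone S z. \<not> \<not> g y < g w + 1 / Suc n))" for n z
  have "almost_all S (Q n)" for n
    unfolding Q_def
  proof (rule jump_cone[OF S])
    have False if w: "\<forall>k. w k \<in> S \<and> \<not> g (w (Suc k)) < g (w k) + 1 / Suc n" for w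
    proof -
      have wS: "w k \<in> S" and wg: "g (w (Suc k)) \<ge> g (w k) + 1 / Suc n" for k
        using w by (auto simp only: not_less)
      have *: "k / Suc n \<le> g (w k)" for k
      proof (induction k)
        case 0 then show ?case using bdd wS by simp
      next
        case (Suc k)
        have "Suc k / Suc n = k / Suc n + 1 / Suc n" by (simp add: add_divide_distrib)
        then show ?case using wg[of k] Suc by linarith
      qed
      \<comment> \<open>Starting at 0 or above, \<open>Suc (Suc n)\<close> jumps overshoot
        1.\<close>
      have "real (Suc (Suc n)) / Suc n > 1" by (simp add: field_simps)
      moreover have "g (w (Suc (Suc n))) \<le> 1" using bdd wS by blast
      ultimately show False using *[of "Suc (Suc n)"] by linarith
    qed
    then show "jumps_finite_below S (\<lambda>x y. \<not> g y < g x + 1 / Suc n)"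
      unfolding jumps_finite_below_def by metis
  qed
  then have "almost_all S (\<lambda>z. \<forall>n\<in>UNIV. Q n z)"
    by (intro almost_all_ball_countable) auto
  then show ?thesis
  proof (rule almost_all_mono, intro ballI)
    fix z y assume z: "z \<in> S" and Q: "\<forall>n\<in>UNIV. Q n z" and y: "y \<in> cone S z"
    have *: "g y < g z + 1 / Suc n" for n
    proof -
      obtain w where w: "w \<in> S" "w \<sqsubset> z" "g y < g w + 1 / Suc n"
        using Q y unfolding Q_def by blast
      then show ?thesis using mono[OF w(1) z w(2)] by simp
    qed
    have "g y - g z \<le> 0"
    proof (rule ccontr)
      assume "\<not> ?thesis"
      then obtain n where "inverse (real (Suc n)) < g y - g z"
        using reals_Archimedean[of "g y - g z"] by auto
      with *[of n] show False by (simp add: field_simps)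
    qed
    moreover have "g z \<le> g y" using mono[OF z] y by auto
    ultimately show "g y = g z" by simp
  qed
qed

section \<open>Uncountable images on cones\<close>

text \<open>Jumps lead from cones with uncountable image to cones with countable image, so two never
  follow one another. Each point with countable cone image then lies in the cone of such a point of
  the countable greedy set.\<close>

lemma countable_image_countable_cones:
  assumes S: "omega1_tame S"
  shows "countable (f ` {x \<in> S. countable (f ` cone S x)})"
proof -
  define B where "B x \<longleftrightarrow> uncountable (f ` cone S x)" for x
  have "jumps_finite_below S (\<lambda>x y. B x \<and> \<not> B y)"
    unfolding jumps_finite_below_def by metis
  then obtain D where D: "D \<subseteq> S" "countable D"
    "\<forall>z\<in>S. z \<in> D \<or> (\<exists>d\<in>D. d \<sqsubset> z \<and> \<not> (B d \<and> \<not> B z) \<and> (\<forall>e\<in>D. e \<sqsubset> z \<longrightarrow> e \<sqsubseteq> d))"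
    by (rule jump_set[OF S])
  have "f ` {x \<in> S. \<not> B x} \<subseteq> (\<Union>d\<in>{d \<in> D. \<not> B d}. f ` cone S d)"
  proof
    fix y assume "y \<in> f ` {x \<in> S. \<not> B x}"
    then obtain x where x: "x \<in> S" "\<not> B x" "y = f x" by blast
    then have "\<exists>d\<in>D. d \<sqsubseteq> x \<and> \<not> B d" using D(3) by metis
    then show "y \<in> (\<Union>d\<in>{d \<in> D. \<not> B d}. f ` cone S d)" using x by blast
  qed
  moreover have "countable (\<Union>d\<in>{d \<in> D. \<not> B d}. f ` cone S d)"
    using D(2) by (intro countable_UN) (auto simp: B_def)
  ultimately have "countable (f ` {x \<in> S. \<not> B x})" by (rule countable_subset)
  then show ?thesis by (simp add: B_def)
qed

text \<open>Otherwise each point of the cone has a countable cone image or lies at or below a member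
  of \<open>D\<close>. Both kinds contribute countably many values, the second by
  \<open>small\<close>.\<close>

lemma almost_all_uncountable_image:
  assumes S: "omega1_tame S" and small: "\<And>a. a \<in> S \<Longrightarrow> countable (f ` {x \<in> S. x \<sqsubseteq> a})"
    and x: "uncountable (f ` cone S x)" and Q: "almost_all (cone S x) Q"
  shows "\<exists>y\<in>cone S x. uncountable (f ` cone S y) \<and> Q y"
proof (rule ccontr)
  assume neg: "\<not> ?thesis"
  obtain D where D: "D \<subseteq> cone S x" "countable D" "\<forall>z\<in>cone S x. (\<forall>d\<in>D. \<not> z \<sqsubseteq> d) \<longrightarrow> Q z"
    using Q unfolding almost_all_def by metis
  have "f ` cone S x \<subseteq> f ` {x \<in> S. countable (f ` cone S x)} \<union> (\<Union>d\<in>D. f ` {x \<in> S. x \<sqsubseteq> d})"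
  proof
    fix v assume "v \<in> f ` cone S x"
    then obtain y where y: "v = f y" "y \<in> cone S x" by blast
    show "v \<in> f ` {x \<in> S. countable (f ` cone S x)} \<union> (\<Union>d\<in>D. f ` {x \<in> S. x \<sqsubseteq> d})"
    proof (cases "Q y")
      case True
      then have "countable (f ` cone S y)" using neg y by metis
      then show ?thesis using y by blast
    next
      case False
      then obtain d where d: "d \<in> D" "y \<sqsubseteq> d" using D(3) y(2) by metis
      then have "y \<in> {x \<in> S. x \<sqsubseteq> d}" using y(2) by simp
      then show ?thesis using d(1) y(1) by (intro UnI2 UN_I[of d] image_eqI[of _ f y]) simp_all
    qed
  qed
  moreover have "countable (\<Union>d\<in>D. f ` {x \<in> S. x \<sqsubseteq> d})"
    using D small by (intro countable_UN) auto
  ultimately show False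
    using x countable_image_countable_cones[OF S, of f] countable_subset by (metis (no_types, lifting) countable_Un)
qed

subsection \<open>Homotopies on trees\<close>

text \<open>Continuity enters in two forms: along each time path, and through \<open>tube\<close>,
  which spreads an open condition over a compact set of times to the points just below.\<close>

lemma countable_end_of_homotopy_small_initial_segments:
  fixes h :: "'a \<times> real \<Rightarrow> 'b"
  assumes S: "omega1_tame S"
    and X: "Hausdorff_space X" "locally_metrizable_space X"
    and path: "\<And>s. s \<in> S \<Longrightarrow> continuous_map (top_of_set {0..1}) X (\<lambda>t. h (s, t))"
    and tube: "\<And>s V A. s \<in> S \<Longrightarrow> openin X V \<Longrightarrow> compact A \<Longrightarrow> A \<subseteq> {0..1} \<Longrightarrow> \<forall>t\<in>A. h (s, t) \<in> V
      \<Longrightarrow> eventually_below S s (\<lambda>x. \<forall>t\<in>A. h (x, t) \<in> V)"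
    and small: "\<And>a. a \<in> S \<Longrightarrow> countable ((\<lambda>s. h (s, 1)) ` {x \<in> S. x \<sqsubseteq> a})"
    and const: "\<And>s. s \<in> S \<Longrightarrow> h (s, 0) = p"
  shows "countable ((\<lambda>s. h (s, 1)) ` S)"
proof (rule ccontr)
  let ?f = "\<lambda>s. h (s, 1)"
  define bad where "bad x \<longleftrightarrow> uncountable (?f ` cone S x)" for x
  assume unc: "uncountable (?f ` S)"
  obtain x0 where x0: "x0 \<in> S" "bad x0"
  proof -
    have "{x \<in> S. countable (?f ` cone S x)} \<noteq> S"
      using countable_image_countable_cones[OF S, of ?f] unc by metis
    then show thesis using that unfolding bad_def by blast
  qed
  define P where "P x c \<longleftrightarrow> (\<forall>t\<in>{0..c}. \<forall>y\<in>cone S x. h (y, t) = h (x, t))" for x c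
  \<comment> \<open>For \<open>x \<in> S\<close> the set contains 0, since
    \<open>h(\<cdot>, 0)\<close> is constant, and the supremum is attained because \<open>X\<close>
    is Hausdorff.\<close>
  define \<tau> where "\<tau> x = Sup {c \<in> {0..1}. P x c}" for x
  have P0: "P x 0" if "x \<in> S" for x
    using const that by (auto simp: P_def)
  have bdd: "bdd_above {c \<in> {0..1}. P x c}" for x
    by (intro bdd_aboveI[of _ 1]) simp
  have \<tau>_upper: "c \<le> \<tau> x" if "0 \<le> c" "c \<le> 1" "P x c" for x c
    unfolding \<tau>_def using bdd that by (intro cSup_upper) simp_all
  have \<tau>_bounds: "0 \<le> \<tau> x \<and> \<tau> x \<le> 1" if "x \<in> S" for x
  proof
    show "0 \<le> \<tau> x" using \<tau>_upper P0[OF that] by simp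
    show "\<tau> x \<le> 1" unfolding \<tau>_def
    proof (rule cSup_least)
      show "{c \<in> {0..1}. P x c} \<noteq> {}" using P0[OF that] by fastforce
    qed simp
  qed
  have P\<tau>: "P x (\<tau> x)" if x: "x \<in> S" for x
    unfolding P_def
  proof (intro ballI)
    fix t y assume t: "t \<in> {0..\<tau> x}" and y: "y \<in> cone S x"
    have eq: "h (y, t') = h (x, t')" if t': "t' \<in> {0..<\<tau> x}" for t'
    proof -
      have "{c \<in> {0..1}. P x c} \<noteq> {}" using P0[OF x] by fastforce
      then obtain c where "c \<in> {c \<in> {0..1}. P x c}" "t' < c"
        using t' less_cSup_iff[OF _ bdd, of x t'] unfolding \<tau>_def by auto
      then show ?thesis using y t' unfolding P_def by auto
    qed
    show "h (y, t) = h (x, t)"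
    \<comment> \<open>For \<open>\<tau> x = 0\<close> the half-open interval is empty and so is its
      closure; constancy at time 0 is used instead.\<close>
    proof (cases "\<tau> x = 0")
      case True
      then show ?thesis using t const x y by auto
    next
      case False
      then have "0 < \<tau> x" using \<tau>_bounds[OF x] by simp
      then have cl: "t \<in> closure {0..<\<tau> x}" using t by simp
      have yS: "y \<in> S" using y by simp
      have "{0..<\<tau> x} \<subseteq> {0..1}" using \<tau>_bounds[OF x] by auto
      then show ?thesis
        using continuous_maps_eq_on_closure[OF X(1) path[OF yS] path[OF x] _ eq cl] by simp
    qed
  qed
  have \<tau>_mono: "\<tau> x \<le> \<tau> y" if "x \<in> S" "y \<in> S" "x \<sqsubset> y" for x y
  proof -
    have "P y (\<tau> x)"
      unfolding P_def
    proof (intro ballI)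
      fix t w assume t: "t \<in> {0..\<tau> x}" and w: "w \<in> cone S y"
      have "w \<in> cone S x" using w that(3) trans[of x y w] by auto
      moreover have "y \<in> cone S x" using that by simp
      ultimately show "h (w, t) = h (y, t)" using P\<tau>[OF that(1)] t unfolding P_def by metis
    qed
    then show ?thesis using \<tau>_upper \<tau>_bounds[OF that(1)] by simp
  qed
  \<comment> \<open>A property that holds almost everywhere on a bad cone can be secured while
    staying at a bad point.\<close>
  have refine: "\<exists>z\<in>cone S x. bad z \<and> Q z"
    if "bad x" "almost_all (cone S x) Q" for x Q
    using almost_all_uncountable_image[OF S small _ that(2)] that(1) unfolding bad_def by simp

  have "almost_all (cone S x0) (\<lambda>z. \<forall>y\<in>cone (cone S x0) z. \<tau> y = \<tau> z)"
    using \<tau>_mono \<tau>_bounds by (intro real_constant_on_cones omega1_tame_cone S) auto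
  from refine[OF x0(2) this] obtain z0 where z0: "z0 \<in> cone S x0" "bad z0" "\<forall>y\<in>cone (cone S x0) z0. \<tau> y = \<tau> z0"
    by (elim bexE conjE) (rule that)
  have z0S: "z0 \<in> S" using z0(1) by simp
  define c where "c = \<tau> z0"
  have \<tau>c: "\<tau> y = c" if "y \<in> cone S z0" for y
    using z0(3) that unfolding cone_cone[OF z0(1)] c_def by blast
  have c01: "0 \<le> c" "c \<le> 1" using \<tau>_bounds[OF z0S] by (simp_all add: c_def)
  have "c \<noteq> 1"
  proof
    assume "c = 1"
    then have "?f ` cone S z0 \<subseteq> {h (z0, 1)}"
      using P\<tau>[OF z0S] unfolding P_def c_def by auto
    then show False using z0(2) countable_subset unfolding bad_def by (metis countable_empty countable_insert)
  qed
  then have c1: "c < 1" using c01 by simp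
  have hc: "h (y, c) = h (z0, c)" if "y \<in> cone S z0" for y
    using P\<tau>[OF z0S] that c01 unfolding P_def c_def by auto
  have "h (z0, c) \<in> topspace X"
    using continuous_map_image_subset_topspace[OF path[OF z0S]] c01 by auto
  then obtain U where U: "openin X U" "h (z0, c) \<in> U" "metrizable_space (subtopology X U)"
    using X(2) unfolding locally_metrizable_space_def by meson

  \<comment> \<open>These intervals shrink to \<open>{c}\<close>, are cut off at 1 to stay in the
    time domain, and are compact as \<open>tube\<close> demands.\<close>
  define I where "I n = {c..min 1 (c + 1 / Suc n)}" for n :: nat
  have I01: "I n \<subseteq> {0..1}" for n using c01 by (auto simp: I_def)
  have I_anti: "I n \<subseteq> I m" if "m \<le> n" for m n
  proof -
    have "1 / real (Suc n) \<le> 1 / real (Suc m)" using that by (simp add: field_simps)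
    then show ?thesis by (auto simp: I_def)
  qed
  \<comment> \<open>The least index exists since every path over the cone of \<open>z0\<close> is at
    \<open>h (z0, c) \<in> U\<close> at time \<open>c\<close>. It is upper semicontinuous from
    below: by \<open>tube\<close>, the interval that works at \<open>s\<close> works just below
    \<open>s\<close>.\<close>
  define n where "n y = (LEAST n. \<forall>t\<in>I n. h (y, t) \<in> U)" for y
  have n_ex: "\<exists>n. \<forall>t\<in>I n. h (y, t) \<in> U" if y: "y \<in> cone S z0" for y
  proof -
    have yS: "y \<in> S" using y by simp
    have "openin (top_of_set {0..1}) {t \<in> {0..1}. h (y, t) \<in> U}"
      using openin_continuous_map_preimage[OF path[OF yS] U(1)] by simp
    moreover have "c \<in> {t \<in> {0..1}. h (y, t) \<in> U}" using hc[OF y] U(2) c01 by simp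
    ultimately obtain e where e: "e > 0" "\<forall>t\<in>{0..1}. dist t c < e \<longrightarrow> t \<in> {t \<in> {0..1}. h (y, t) \<in> U}"
      unfolding openin_euclidean_subtopology_iff by meson
    obtain m where m: "inverse (real (Suc m)) < e" using reals_Archimedean[OF e(1)] by blast
    have "h (y, t) \<in> U" if t: "t \<in> I m" for t
    proof -
      have "t \<in> {0..1}" using I01 t by blast
      moreover have "dist t c < e" using t m unfolding I_def by (auto simp: dist_real_def inverse_eq_divide)
      ultimately show ?thesis using e(2) by blast
    qed
    then show ?thesis by blast
  qed
  have n_U: "\<forall>t\<in>I (n y). h (y, t) \<in> U" if "y \<in> cone S z0" for y
    unfolding n_def by (rule LeastI_ex[OF n_ex[OF that]])
  have "almost_all (cone S z0) (\<lambda>z. \<exists>N. \<forall>y\<in>cone (cone S z0) z. n y \<le> N)"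
  proof (rule nat_bounded_on_cones[OF omega1_tame_cone[OF S]])
    fix s assume s: "s \<in> cone S z0"
    have sS: "s \<in> S" using s by simp
    have "eventually_below S s (\<lambda>x. \<forall>t\<in>I (n s). h (x, t) \<in> U)"
      by (rule tube[OF sS U(1) _ I01 n_U[OF s]]) (simp add: I_def)
    then show "eventually_below (cone S z0) s (\<lambda>x. n x \<le> n s)"
    proof (rule eventually_below_mono)
      fix x assume "\<forall>t\<in>I (n s). h (x, t) \<in> U"
      then show "n x \<le> n s" unfolding n_def[of x] by (rule Least_le)
    qed blast
  qed
  from refine[OF z0(2) this] obtain z1 N where z1: "z1 \<in> cone S z0" "bad z1" "\<forall>y\<in>cone (cone S z0) z1. n y \<le> N"
    by (elim bexE conjE exE) (rule that)
  have z1_sub: "cone S z1 \<subseteq> cone S z0" using z1(1) trans by auto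
  have U1: "h (y, t) \<in> U" if y: "y \<in> cone S z1" and t: "t \<in> I N" for y t
  proof -
    have "n y \<le> N" using z1(3) y unfolding cone_cone[OF z1(1)] by blast
    then show ?thesis using n_U[of y] y z1_sub I_anti[of "n y" N] t by blast
  qed
  define b where "b = min 1 (c + 1 / Suc N)"
  have b: "c < b" "b \<le> 1" using c1 by (simp_all add: b_def)

  obtain M d where Md: "Metric_space M d" "subtopology X U = Metric_space.mtopology M d"
    using U(3) unfolding metrizable_space_def by blast
  interpret Metric_space M d by (rule Md)
  have MU: "U = M"
  proof -
    have "topspace (subtopology X U) = M" using Md(2) by simp
    then show ?thesis using openin_subset[OF U(1)] by auto
  qed
  have open_ball: "openin X (mball x e)" for x e
    using openin_mball[of x e] openin_trans_full[OF _ U(1)] unfolding Md(2)[symmetric] by blast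
  \<comment> \<open>Countably many times can be treated at once, and by density they determine the
    paths on \<open>[c, b]\<close>.\<close>
  define R where "R = {c<..<b} \<inter> \<rat>"
  have "almost_all (cone S z1) (\<lambda>z. \<forall>t\<in>R. \<forall>y\<in>cone (cone S z1) z. h (y, t) = h (z, t))"
  proof (rule almost_all_ball_countable)
    show "countable R" unfolding R_def using countable_rat by (rule countable_Int2)
    fix t assume "t \<in> R"
    then have t: "t \<in> I N" by (auto simp: R_def I_def b_def)
    show "almost_all (cone S z1) (\<lambda>z. \<forall>y\<in>cone (cone S z1) z. h (y, t) = h (z, t))"
    proof (rule metric_constant_on_cones[OF omega1_tame_cone[OF S] Md(1)])
      show "h (x, t) \<in> M" if "x \<in> cone S z1" for x using U1[OF that t] MU by simp
      fix s and e :: real assume s: "s \<in> cone S z1" and e: "e > 0"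
      have sS: "s \<in> S" using s by simp
      have "\<forall>t\<in>{t}. h (s, t) \<in> mball (h (s, t)) e"
        using U1[OF s t] e MU by simp
      then have "eventually_below S s (\<lambda>x. \<forall>t'\<in>{t}. h (x, t') \<in> mball (h (s, t)) e)"
        using subsetD[OF I01 t] e by (intro tube[OF sS open_ball]) simp_all
      then show "eventually_below (cone S z1) s (\<lambda>x. d (h (s, t)) (h (x, t)) < e)"
        by (rule eventually_below_mono) auto
    qed
  qed
  from refine[OF z1(2) this] obtain z2 where z2: "z2 \<in> cone S z1" "bad z2" "\<forall>t\<in>R. \<forall>y\<in>cone (cone S z1) z2. h (y, t) = h (z2, t)"
    by (elim bexE conjE) (rule that)
  have z20: "z2 \<in> cone S z0" and z2S: "z2 \<in> S" using z2(1) z1_sub by auto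
  \<comment> \<open>Up to \<open>c\<close> this is the attained supremum
    \<open>\<tau> z2 = c\<close>; beyond \<open>c\<close> it comes from agreement on
    \<open>R\<close>. It contradicts \<open>c < b\<close>.\<close>
  have "P z2 b"
    unfolding P_def
  proof (intro ballI)
    fix t y assume t: "t \<in> {0..b}" and y: "y \<in> cone S z2"
    have yS: "y \<in> S" using y by simp
    show "h (y, t) = h (z2, t)"
    proof (cases "t \<le> c")
      case True
      then show ?thesis using P\<tau>[OF z2S] \<tau>c[OF z20] y t unfolding P_def by auto
    next
      case False
      have "{c<..<b} \<subseteq> closure R"
        using open_Int_closure_subset[of "{c<..<b}" "\<rat>"] Rats_closure_real unfolding R_def by simp
      then have "closure {c<..<b} \<subseteq> closure R" by (rule closure_minimal) simp
      then have cl: "t \<in> closure R" using b t False by auto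
      have "R \<subseteq> {0..1}" using b c01 by (auto simp: R_def)
      moreover have "h (y, t') = h (z2, t')" if "t' \<in> R" for t'
        using z2(3) that y unfolding cone_cone[OF z2(1)] by blast
      ultimately show ?thesis
        by (rule continuous_maps_eq_on_closure[OF X(1) path[OF yS] path[OF z2S] _ _ cl])
    qed
  qed
  then have "b \<le> \<tau> z2" using b c01 by (intro \<tau>_upper) simp_all
  then show False using \<tau>c[OF z20] b by simp
qed


section \<open>Initial segments with uncountable image\<close>

text \<open>If some predecessor \<open>u\<close> of \<open>s\<close> is not below \<open>a\<close>,
  no point of the segment lies above \<open>u\<close>. Otherwise the Hausdorff condition keeps
  \<open>s\<close> off limit levels. In topological terms, initial segments are closed.\<close>

lemma eventually_below_initial_segment:
  assumes hausdorff: "\<And>x y. \<exists>v. v \<sqsubset> x \<Longrightarrow> \<forall>v. v \<sqsubset> x \<longrightarrow> (\<exists>w. v \<sqsubset> w \<and> w \<sqsubset> x) \<Longrightarrow>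
      \<forall>v. v \<sqsubset> x \<longleftrightarrow> v \<sqsubset> y \<Longrightarrow> x = y"
    and s: "\<not> s \<sqsubseteq> a"
  shows "eventually_below {x. x \<sqsubseteq> a} s (\<lambda>_. False)"
  unfolding eventually_below_def
proof (intro allI impI)
  fix v assume v: "v \<sqsubset> s"
  show "\<exists>u. u \<sqsubset> s \<and> (\<forall>x\<in>{x. x \<sqsubseteq> a}. u \<sqsubset> x \<longrightarrow> x \<sqsubset> s \<longrightarrow> False)"
  proof (cases "\<forall>u. u \<sqsubset> s \<longrightarrow> u \<sqsubset> a")
    case False
    then obtain u where u: "u \<sqsubset> s" "\<not> u \<sqsubset> a" by blast
    have "\<not> u \<sqsubset> x" if "x \<sqsubseteq> a" for x
      using that u(2) trans[of u x a] by metis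
    then show ?thesis using u(1) by (intro exI[of _ u]) simp
  next
    case True
    \<comment> \<open>A first point \<open>m\<close> of the segment not below \<open>s\<close> has
      the same predecessors as \<open>s\<close>. At a limit level they would coincide, putting
      \<open>s\<close> into the segment.\<close>
    then have "a \<in> {x. x \<sqsubseteq> a \<and> \<not> x \<sqsubset> s}" using irrefl by blast
    from minimal_element[OF this] obtain m where "m \<in> {x. x \<sqsubseteq> a \<and> \<not> x \<sqsubset> s}"
      and min: "\<forall>y. y \<sqsubset> m \<longrightarrow> y \<notin> {x. x \<sqsubseteq> a \<and> \<not> x \<sqsubset> s}"
      by (elim bexE) (rule that)
    then have m: "m \<sqsubseteq> a" "\<not> m \<sqsubset> s" by simp_all
    have preds: "u \<sqsubset> s \<longleftrightarrow> u \<sqsubset> m" for u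
    proof
      assume u: "u \<sqsubset> s"
      have "u = m \<or> u \<sqsubset> m \<or> m \<sqsubset> u" using linear[of u a m] True u m(1) by metis
      then show "u \<sqsubset> m" using u m(2) trans[of m u s] by metis
    next
      assume u: "u \<sqsubset> m"
      then have "u \<sqsubset> a" using m(1) trans[of u m a] by metis
      then show "u \<sqsubset> s" using min[rule_format, OF u] by simp
    qed
    have "\<not> (\<forall>u. u \<sqsubset> s \<longrightarrow> (\<exists>w. u \<sqsubset> w \<and> w \<sqsubset> s))"
    proof
      assume "\<forall>u. u \<sqsubset> s \<longrightarrow> (\<exists>w. u \<sqsubset> w \<and> w \<sqsubset> s)"
      then have "s = m" using hausdorff[of s m] v preds by blast
      then show False using m(1) s by simp
    qed
    then show ?thesis by blast
  qed
qed

lemma countable_end_of_homotopy: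
  fixes h :: "'a \<times> real \<Rightarrow> 'b"
  assumes hausdorff: "\<And>x y. \<exists>v. v \<sqsubset> x \<Longrightarrow> \<forall>v. v \<sqsubset> x \<longrightarrow> (\<exists>w. v \<sqsubset> w \<and> w \<sqsubset> x) \<Longrightarrow>
      \<forall>v. v \<sqsubset> x \<longleftrightarrow> v \<sqsubset> y \<Longrightarrow> x = y"
    and S: "omega1_tame S"
    and X: "Hausdorff_space X" "locally_metrizable_space X"
    and path: "\<And>s. s \<in> S \<Longrightarrow> continuous_map (top_of_set {0..1}) X (\<lambda>t. h (s, t))"
    and tube: "\<And>s V A. s \<in> S \<Longrightarrow> openin X V \<Longrightarrow> compact A \<Longrightarrow> A \<subseteq> {0..1} \<Longrightarrow> \<forall>t\<in>A. h (s, t) \<in> V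
      \<Longrightarrow> eventually_below S s (\<lambda>x. \<forall>t\<in>A. h (x, t) \<in> V)"
    and const: "\<And>s. s \<in> S \<Longrightarrow> h (s, 0) = p"
  shows "countable ((\<lambda>s. h (s, 1)) ` S)"
proof (cases "\<forall>a\<in>S. countable ((\<lambda>s. h (s, 1)) ` {x \<in> S. x \<sqsubseteq> a})")
  case True
  show ?thesis
    by (rule countable_end_of_homotopy_small_initial_segments[OF S X path tube _ const]) (use True in blast)+
next
  case False
  let ?f = "\<lambda>s. h (s, 1)"
  obtain a' where "a' \<in> {a \<in> S. uncountable (?f ` {x \<in> S. x \<sqsubseteq> a})}"
    using False by blast
  from minimal_element[OF this] obtain a where "a \<in> {a \<in> S. uncountable (?f ` {x \<in> S. x \<sqsubseteq> a})}"
    and min: "\<forall>y. y \<sqsubset> a \<longrightarrow> y \<notin> {a \<in> S. uncountable (?f ` {x \<in> S. x \<sqsubseteq> a})}"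
    by (elim bexE) (rule that)
  then have aS: "a \<in> S" and unc: "uncountable (?f ` {x \<in> S. x \<sqsubseteq> a})" by simp_all
  define K where "K = {x \<in> S. x \<sqsubset> a}"
  have KS: "K \<subseteq> S" by (auto simp: K_def)
  have "{x \<in> S. x \<sqsubseteq> a} = insert a K" using aS by (auto simp: K_def)
  then have uncK: "uncountable (?f ` K)" using unc by simp
  have small: "countable (?f ` {x \<in> S. x \<sqsubseteq> y})" if "y \<in> K" for y
    using min that by (simp add: K_def)
  have smallK: "countable (?f ` {x \<in> K. x \<sqsubseteq> y})" if "y \<in> K" for y
    using small[OF that] by (rule countable_subset[rotated]) (use KS in blast)
  have a_isolated: "eventually_below K a (\<lambda>_. False)"
  proof (rule ccontr)
    assume "\<not> ?thesis"
    then have lim: "\<exists>v. v \<sqsubset> a" "\<forall>u. u \<sqsubset> a \<longrightarrow> (\<exists>x\<in>K. u \<sqsubset> x)"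
      unfolding eventually_below_def by blast+
    have "?f a \<in> topspace X"
      using continuous_map_image_subset_topspace[OF path[OF aS]] by auto
    then obtain U where U: "openin X U" "?f a \<in> U" "metrizable_space (subtopology X U)"
      using X(2) unfolding locally_metrizable_space_def by meson
    obtain M d where Md: "Metric_space M d" "subtopology X U = Metric_space.mtopology M d"
      using U(3) unfolding metrizable_space_def by blast
    interpret Metric_space M d by (rule Md)
    have MU: "U = M"
    proof -
      have "topspace (subtopology X U) = M" using Md(2) by simp
      then show ?thesis using openin_subset[OF U(1)] by auto
    qed
    \<comment> \<open>Each ball of a countable base at \<open>h (a, 1)\<close> yields a threshold in
      \<open>K\<close> beyond which all values below \<open>a\<close> lie in the ball.\<close>
    have "\<exists>w\<in>K. \<forall>x\<in>S. w \<sqsubset> x \<longrightarrow> x \<sqsubset> a \<longrightarrow> ?f x \<in> mball (?f a) (1 / Suc n)" for n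
    proof -
      have op: "openin X (mball (?f a) (1 / Suc n))"
        using openin_mball[of "?f a" "1 / Suc n"] openin_trans_full[OF _ U(1)] unfolding Md(2)[symmetric] by blast
      have "\<forall>t\<in>{1}. h (a, t) \<in> mball (?f a) (1 / Suc n)" using U(2) MU by simp
      then have "eventually_below S a (\<lambda>x. \<forall>t\<in>{1}. h (x, t) \<in> mball (?f a) (1 / Suc n))"
        by (intro tube[OF aS op]) auto
      then obtain u where u: "u \<sqsubset> a" "\<forall>x\<in>S. u \<sqsubset> x \<longrightarrow> x \<sqsubset> a \<longrightarrow> ?f x \<in> mball (?f a) (1 / Suc n)"
        using lim(1) eventually_belowD by fastforce
      obtain w where w: "w \<in> K" "u \<sqsubset> w" using lim(2) u(1) by blast
      have "?f x \<in> mball (?f a) (1 / Suc n)" if "x \<in> S" "w \<sqsubset> x" "x \<sqsubset> a" for x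
        using u(2) that trans[OF w(2) that(2)] by blast
      with w(1) show ?thesis by blast
    qed
    then obtain w where w: "\<And>n. w n \<in> K" "\<And>n. \<forall>x\<in>S. w n \<sqsubset> x \<longrightarrow> x \<sqsubset> a \<longrightarrow> ?f x \<in> mball (?f a) (1 / Suc n)"
      by metis
    \<comment> \<open>A point of \<open>K\<close> is either at or below some \<open>w n\<close>, in
      a segment with countable image, or above all of them, and then its value has distance 0 from
      \<open>h (a, 1)\<close>.\<close>
    have "?f ` K \<subseteq> insert (?f a) (\<Union>n. ?f ` {x \<in> S. x \<sqsubseteq> w n})"
    proof
      fix y assume "y \<in> ?f ` K"
      then obtain x where x: "x \<in> S" "x \<sqsubset> a" "y = ?f x" unfolding K_def by blast
      show "y \<in> insert (?f a) (\<Union>n. ?f ` {x \<in> S. x \<sqsubseteq> w n})"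
      proof (cases "\<exists>n. x \<sqsubseteq> w n")
        case True
        then obtain n where "x \<in> {x \<in> S. x \<sqsubseteq> w n}" using x(1) by blast
        then show ?thesis using x(3) by blast
      next
        case False
        have ball: "?f x \<in> mball (?f a) (1 / Suc n)" for n
        proof -
          have "w n \<sqsubset> a" using w(1)[of n] by (simp add: K_def)
          then have "w n \<sqsubset> x" using linear[of "w n" a x] x(2) False by metis
          then show ?thesis using w(2)[of n] x by blast
        qed
        have "d (?f a) (?f x) \<le> 0"
        proof (rule ccontr)
          assume "\<not> ?thesis"
          then obtain n where "inverse (real (Suc n)) < d (?f a) (?f x)"
            using reals_Archimedean[of "d (?f a) (?f x)"] by auto
          with ball[of n] show False by (simp add: field_simps)
        qed
        with nonneg[of "?f a" "?f x"] have "d (?f a) (?f x) = 0" by linarith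
        moreover have "?f a \<in> M" "?f x \<in> M" using ball[of 0] by simp_all
        ultimately show ?thesis using zero[of "?f a" "?f x"] x(3) by simp
      qed
    qed
    moreover have "countable (insert (?f a) (\<Union>n. ?f ` {x \<in> S. x \<sqsubseteq> w n}))"
      using small w(1) by simp
    ultimately have "countable (?f ` K)" by (rule countable_subset)
    with uncK show False by blast
  qed
  have K: "omega1_tame K"
  proof (rule omega1_tame_closed[OF S KS])
    fix s assume s: "s \<in> S - K"
    show "eventually_below K s (\<lambda>_. False)"
    \<comment> \<open>Points other than \<open>a\<close> lie outside the closed initial segment of
      \<open>a\<close>, so only \<open>a\<close> calls for \<open>a_isolated\<close>.\<close>
    proof (cases "s = a")
      case True
      then show ?thesis using a_isolated by simp
    next
      case False
      then have "\<not> s \<sqsubseteq> a" using s by (simp add: K_def)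
      from eventually_below_initial_segment[OF hausdorff this]
      have "eventually_below {x. x \<sqsubseteq> a} s (\<lambda>_. False)" by blast
      then show ?thesis by (rule eventually_below_mono) (auto simp: K_def)
    qed
  qed
  have "countable (?f ` K)"
  proof (rule countable_end_of_homotopy_small_initial_segments[OF K X])
    show "continuous_map (top_of_set {0..1}) X (\<lambda>t. h (s, t))" if "s \<in> K" for s
      using path KS that by blast
    show "eventually_below K s (\<lambda>x. \<forall>t\<in>A. h (x, t) \<in> V)"
      if "s \<in> K" "openin X V" "compact A" "A \<subseteq> {0..1}" "\<forall>t\<in>A. h (s, t) \<in> V" for s V A
    proof -
      have "s \<in> S" using KS that(1) by blast
      from tube[OF this that(2-5)] show ?thesis by (rule eventually_below_mono[OF _ KS])
    qed
    show "h (s, 0) = p" if "s \<in> K" for s using const KS that by blast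
  qed (rule smallK)
  with uncK show ?thesis by blast
qed

end

subsection \<open>The interval topology\<close>

text \<open>For well-foundedness, a set \<open>Q\<close> containing \<open>x\<close> has as minimal
  element \<open>x\<close> itself or a least element of \<open>Q\<close> among the predecessors of
  \<open>x\<close>.\<close>

lemma tree_order_underS:
  assumes "hausdorff_tree T r"
  shows "tree_order (\<lambda>x y. x \<in> underS r y)"
proof
  have rT: "r \<subseteq> T \<times> T" and "trans r" and "antisym r"
    and wo: "\<And>x. x \<in> T \<Longrightarrow> well_order_on (underS r x) (Restr r (underS r x))"
    using assms by (auto simp: hausdorff_tree_def partial_order_on_def preorder_on_def refl_on_def)
  show tr: "x \<in> underS r z" if "x \<in> underS r y" "y \<in> underS r z" for x y z
  proof -
    have "(x, y) \<in> r" "(y, z) \<in> r" "y \<noteq> z" using that by (auto simp: underS_def)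
    moreover from this have "(x, z) \<in> r" using \<open>trans r\<close> by (meson transD)
    moreover have "x \<noteq> z" using calculation \<open>antisym r\<close> by (meson antisymD)
    ultimately show ?thesis by (simp add: underS_def)
  qed
  show "x = y \<or> x \<in> underS r y \<or> y \<in> underS r x" if "x \<in> underS r z" "y \<in> underS r z" for x y z
  proof -
    have "z \<in> T" using that(1) rT by (auto simp: underS_def)
    then have "total_on (underS r z) (Restr r (underS r z))"
      using wo unfolding well_order_on_def linear_order_on_def by blast
    then have "x \<noteq> y \<longrightarrow> (x, y) \<in> r \<or> (y, x) \<in> r"
      using that unfolding total_on_def by blast
    then show ?thesis by (auto simp: underS_def)
  qed
  show "wf {(x, y). x \<in> underS r y}"
  proof (rule wfI_min)
    fix x :: 'a and Q assume x: "x \<in> Q"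
    show "\<exists>z\<in>Q. \<forall>y. (y, z) \<in> {(x, y). x \<in> underS r y} \<longrightarrow> y \<notin> Q"
    proof (cases "underS r x \<inter> Q = {}")
      case True
      then show ?thesis using x by blast
    next
      case False
      then obtain y where y: "y \<in> underS r x \<inter> Q" by blast
      then have "x \<in> T" using rT by (auto simp: underS_def)
      then have "wf (Restr r (underS r x) - Id)" using wo unfolding well_order_on_def by blast
      from wfE_min[OF this y] obtain m where m: "m \<in> underS r x \<inter> Q"
        "\<And>w. (w, m) \<in> Restr r (underS r x) - Id \<Longrightarrow> w \<notin> underS r x \<inter> Q" by metis
      have "w \<notin> Q" if w: "w \<in> underS r m" for w
      proof -
        have "w \<in> underS r x" using tr[OF w] m(1) by blast
        moreover have "(w, m) \<in> Restr r (underS r x) - Id"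
          using w m(1) calculation by (auto simp: underS_def)
        ultimately show ?thesis using m(2) by blast
      qed
      then show ?thesis using m(1) by blast
    qed
  qed
qed

locale tree_space =
  fixes T :: "'a set" and r :: "'a rel"
  assumes tree: "hausdorff_tree T r"
begin

sublocale tree_order "\<lambda>x y. x \<in> underS r y"
  by (rule tree_order_underS[OF tree])

lemma underS_in_carrier:
  assumes "x \<in> underS r y"
  shows "x \<in> T" "y \<in> T"
  using assms tree
  by (auto simp: underS_def hausdorff_tree_def partial_order_on_def preorder_on_def refl_on_def)

lemma eventually_below_openin:
  assumes "openin (tree_topology T r) W" "s \<in> W"
  shows "eventually_below T s (\<lambda>x. x \<in> W)"
proof -
  let ?B = "{{x \<in> T. s \<in> underS r x \<and> (x, t) \<in> r} |s t. s \<in> T \<and> t \<in> T} \<union>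
      {{t} |t. t \<in> T \<and> underS r t = {}}"
  have transr: "trans r"
    using tree by (auto simp: hausdorff_tree_def partial_order_on_def preorder_on_def)
  have "generate_topology_on ?B W"
    using assms(1) unfolding tree_topology_def openin_topology_generated_by_iff .
  \<comment> \<open>Treating all points of the set at once carries the induction through
    intersections and unions. An interval \<open>(a, t]\<close> containing \<open>s\<close> contains
    all points between \<open>a\<close> and \<open>s\<close>; at minimal points the claim is
    vacuous.\<close>
  then have "\<forall>s\<in>W. eventually_below T s (\<lambda>x. x \<in> W)"
  proof (induction rule: generate_topology_on.induct)
    case Empty
    then show ?case by simp
  next
    case (Int a b)
    then show ?case using eventually_below_conj[of T] by simp
  next
    case (UN K)
    show ?case
    proof
      fix s assume "s \<in> \<Union>K"
      then obtain k where k: "k \<in> K" "s \<in> k" by blast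
      then have "eventually_below T s (\<lambda>x. x \<in> k)" using UN by blast
      then show "eventually_below T s (\<lambda>x. x \<in> \<Union>K)"
        by (rule eventually_below_mono) (use k in blast)+
    qed
  next
    case (Basis B)
    then consider a t where "B = {x \<in> T. a \<in> underS r x \<and> (x, t) \<in> r}"
      | t where "B = {t}" "underS r t = {}" by blast
    then show ?case
    proof cases
      case (1 a t)
      have "eventually_below T s (\<lambda>x. x \<in> B)" if s: "s \<in> B" for s
      proof -
        have "x \<in> B" if x: "x \<in> T" "a \<in> underS r x" "x \<in> underS r s" for x
        proof -
          have "(x, s) \<in> r" "(s, t) \<in> r" using x s unfolding 1 by (auto simp: underS_def)
          then have "(x, t) \<in> r" using transr by (meson transD)
          then show ?thesis using x unfolding 1 by simp
        qed
        moreover have "a \<in> underS r s" using s unfolding 1 by simp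
        ultimately show ?thesis unfolding eventually_below_def by blast
      qed
      then show ?thesis by blast
    next
      case (2 t)
      then show ?thesis unfolding eventually_below_def by simp
    qed
  qed
  with assms(2) show ?thesis by blast
qed

text \<open>The neighbourhood is the basic interval \<open>(u, s]\<close> with \<open>u\<close> from
  \<open>eventually_below\<close>, or the singleton of a minimal \<open>s\<close>.\<close>

lemma open_interval_nhd:
  assumes s: "s \<in> T" and C: "eventually_below C s (\<lambda>_. False)"
  obtains W where "openin (tree_topology T r) W" "s \<in> W" "W \<inter> C \<subseteq> {s}"
proof (cases "underS r s = {}")
  case True
  then have "openin (tree_topology T r) {s}"
    unfolding tree_topology_def using s by (intro topology_generated_by_Basis) blast
  then show thesis by (rule that) auto
next
  case False
  then obtain u where u: "u \<in> underS r s" "\<forall>c\<in>C. u \<in> underS r c \<longrightarrow> c \<notin> underS r s"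
    using C unfolding eventually_below_def by blast
  have uT: "u \<in> T" using underS_in_carrier u(1) by blast
  have ss: "(s, s) \<in> r"
    using s tree by (auto simp: hausdorff_tree_def partial_order_on_def preorder_on_def refl_on_def)
  let ?W = "{x \<in> T. u \<in> underS r x \<and> (x, s) \<in> r}"
  have "openin (tree_topology T r) ?W"
    unfolding tree_topology_def using s uT by (intro topology_generated_by_Basis) blast
  moreover have "s \<in> ?W" using s u(1) ss by simp
  moreover have "?W \<inter> C \<subseteq> {s}" using u(2) by (auto simp: underS_def)
  ultimately show thesis by (rule that)
qed

text \<open>Neighbourhoods of \<open>s\<close> that meet \<open>C\<close> at most in
  \<open>s\<close> show both that \<open>C\<close> is closed and that it is discrete.\<close>

lemma omega1_tame_if_omega1_compact:
  assumes ST: "S \<subseteq> T" and S: "omega1_compact_space (subtopology (tree_topology T r) S)"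
  shows "omega1_tame S"
  unfolding omega1_tame_def
proof (intro allI impI)
  let ?S = "subtopology (tree_topology T r) S"
  fix C assume C: "C \<subseteq> S" and *: "\<forall>s\<in>S. eventually_below C s (\<lambda>_. False)"
  have topS: "topspace ?S = S" using ST by (simp add: topspace_tree_topology[OF tree] Int_absorb1)
  have nhd: "\<exists>W. openin ?S W \<and> s \<in> W \<and> W \<inter> C \<subseteq> {s}" if s: "s \<in> S" for s
  proof -
    have "s \<in> T" using s ST by blast
    moreover have "eventually_below C s (\<lambda>_. False)" using * s by blast
    ultimately obtain W where W: "openin (tree_topology T r) W" "s \<in> W" "W \<inter> C \<subseteq> {s}"
      by (rule open_interval_nhd)
    have "openin ?S (S \<inter> W)" using W(1) by (rule openin_subtopology_Int2)
    then show ?thesis using W s by (intro exI[of _ "S \<inter> W"]) auto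
  qed
  have "openin ?S (S - C)"
  proof (subst openin_subopen, intro ballI)
    fix s assume s: "s \<in> S - C"
    then obtain W where W: "openin ?S W" "s \<in> W" "W \<inter> C \<subseteq> {s}" using nhd by blast
    have "W \<subseteq> S" using openin_subset[OF W(1)] topS by simp
    then show "\<exists>V. openin ?S V \<and> s \<in> V \<and> V \<subseteq> S - C" using W s by (intro exI[of _ W]) auto
  qed
  then have "closedin ?S C" unfolding closedin_def topS using C by simp
  moreover have "subtopology ?S C = discrete_topology C"
  proof -
    have "openin (subtopology ?S C) {x}" if x: "x \<in> C" for x
    proof -
      obtain W where W: "openin ?S W" "x \<in> W" "W \<inter> C \<subseteq> {x}" using nhd x C by blast
      have "openin (subtopology ?S C) (C \<inter> W)" using W(1) by (rule openin_subtopology_Int2)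
      moreover have "C \<inter> W = {x}" using W x by blast
      ultimately show ?thesis by simp
    qed
    moreover have "topspace (subtopology ?S C) = C" using topS C by (simp add: Int_absorb1)
    ultimately have "discrete_topology C = subtopology ?S C"
      unfolding discrete_topology_unique by blast
    then show ?thesis by simp
  qed
  ultimately show "countable C" using S unfolding omega1_compact_space_def by blast
qed

text \<open>The tube lemma over \<open>A\<close> gives a neighbourhood of \<open>s\<close> in
  \<open>S\<close>, which contains all points of \<open>S\<close> just below
  \<open>s\<close>.\<close>

lemma eventually_below_tube:
  fixes h :: "'a \<times> real \<Rightarrow> 'b"
  assumes ST: "S \<subseteq> T"
    and h: "continuous_map (prod_topology (subtopology (tree_topology T r) S) (top_of_set {0..1})) X h"
    and s: "s \<in> S" and V: "openin X V" and A: "compact A" "A \<subseteq> {0..1}" "\<forall>t\<in>A. h (s, t) \<in> V"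
  shows "eventually_below S s (\<lambda>x. \<forall>t\<in>A. h (x, t) \<in> V)"
proof -
  let ?S = "subtopology (tree_topology T r) S" and ?I = "top_of_set {0..1::real}"
  have topS: "topspace ?S = S" using ST by (simp add: topspace_tree_topology[OF tree] Int_absorb1)
  define W where "W = {z \<in> S \<times> {0..1}. h z \<in> V}"
  have W: "openin (prod_topology ?S ?I) W"
    using openin_continuous_map_preimage[OF h V] unfolding W_def topspace_prod_topology topS by simp
  have "{s} \<times> A \<subseteq> W" using s A(2,3) by (auto simp: W_def)
  moreover have "compactin ?I A" using A(1,2) by (simp add: compactin_subtopology)
  ultimately obtain O' I' where O': "openin ?S O'" "s \<in> O'" "A \<subseteq> I'" "O' \<times> I' \<subseteq> W"
    using tube_lemma_right[OF W] s topS by metis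
  obtain O2 where O2: "openin (tree_topology T r) O2" "O' = O2 \<inter> S"
    using O'(1) unfolding openin_subtopology by blast
  then have "eventually_below T s (\<lambda>x. x \<in> O2)" using O'(2) by (intro eventually_below_openin) auto
  then show ?thesis
  proof (rule eventually_below_mono[OF _ ST])
    fix x assume "x \<in> S" "x \<in> O2"
    then show "\<forall>t\<in>A. h (x, t) \<in> V" using O2(2) O'(3,4) unfolding W_def by blast
  qed
qed

end

theorem theorem1p3:
  fixes T S :: "'a set" and r :: "'a rel" and X :: "'b topology"
  assumes "hausdorff_tree T r"
    and "S \<subseteq> T" and "uncountable S"
    and "omega1_compact_space (subtopology (tree_topology T r) S)"
    and "Hausdorff_space X" and "locally_metrizable_space X"
  shows "(\<nexists>h. continuous_map
                (prod_topology (subtopology (tree_topology T r) S) (top_of_set {0..1::real})) X h \<and>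
              uncountable ((\<lambda>s. h (s, 1)) ` S) \<and>
              (\<lambda>s. h (s, 0)) constant_on S) \<and>
         ((\<exists>Y\<subseteq>topspace X. subtopology X Y homeomorphic_space subtopology (tree_topology T r) S) \<longrightarrow>
          \<not> contractible_space X)"
proof -
  let ?S = "subtopology (tree_topology T r) S" and ?I = "top_of_set {0..1::real}"
  interpret tree_space T r by unfold_locales (rule assms(1))
  have topS: "topspace ?S = S"
    using assms(2) by (simp add: topspace_tree_topology[OF assms(1)] Int_absorb1)
  have no_homotopy: False
    if h: "continuous_map (prod_topology ?S ?I) X h"
      and unc: "uncountable ((\<lambda>s. h (s, 1)) ` S)" and const: "(\<lambda>s. h (s, 0)) constant_on S" for h
  proof -
    obtain p where p: "\<forall>s\<in>S. h (s, 0) = p" using const unfolding constant_on_def by blast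
    have "countable ((\<lambda>s. h (s, 1)) ` S)"
    proof (rule countable_end_of_homotopy)
      show "omega1_tame S" by (rule omega1_tame_if_omega1_compact[OF assms(2,4)])
      \<comment> \<open>Sharing its predecessors with \<open>x\<close>, the point \<open>y\<close>
        is at a limit level too.\<close>
      show "x = y" if v: "\<exists>v. v \<in> underS r x"
        and lim: "\<forall>v. v \<in> underS r x \<longrightarrow> (\<exists>w. v \<in> underS r w \<and> w \<in> underS r x)"
        and eq: "\<forall>v. v \<in> underS r x \<longleftrightarrow> v \<in> underS r y" for x y
      proof -
        have "x \<in> T" "y \<in> T" using v eq underS_in_carrier by blast+
        moreover have "underS r x = underS r y" using eq by blast
        moreover from this have "at_limit_level r x" "at_limit_level r y"
          using v lim unfolding at_limit_level_def by auto
        ultimately show ?thesis using tree unfolding hausdorff_tree_def by blast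
      qed
      show "continuous_map ?I X (\<lambda>t. h (s, t))" if "s \<in> S" for s
      proof -
        have "continuous_map ?I (prod_topology ?S ?I) (\<lambda>t. (s, t))"
          using that topS by (intro continuous_map_pairedI) simp_all
        from continuous_map_compose[OF this h] show ?thesis by (simp add: comp_def)
      qed
    qed (use assms(5,6) p eventually_below_tube[OF assms(2) h] in simp_all)
    with unc show False by blast
  qed
  moreover have "\<not> contractible_space X"
    if Y: "Y \<subseteq> topspace X" "subtopology X Y homeomorphic_space ?S" for Y
  proof
    assume "contractible_space X"
    then obtain k where k: "continuous_map (prod_topology X ?I) X k"
        "\<forall>x\<in>topspace X. k (x, 1) = x" "(\<lambda>x. k (x, 0)) constant_on topspace X"
      unfolding contractible_space_iff_contraction by blast
    obtain g where g: "homeomorphic_map ?S (subtopology X Y) g"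
      using Y(2) homeomorphic_space_sym homeomorphic_space by metis
    have g_cont: "continuous_map ?S X g"
      using homeomorphic_imp_continuous_map[OF g] continuous_map_in_subtopology by blast
    have gX: "g s \<in> topspace X" if "s \<in> S" for s
      using continuous_map_image_subset_topspace[OF g_cont] that topS by blast
    have "inj_on g S" using homeomorphic_imp_injective_map[OF g] topS by simp
    \<comment> \<open>The embedding followed by the contraction is a homotopy ending at
      \<open>g\<close>, which is injective on the uncountable \<open>S\<close>.\<close>
    define h where "h = k \<circ> (\<lambda>(s, t). (g s, t))"
    show False
    proof (rule no_homotopy)
      have "continuous_map (prod_topology ?S ?I) (prod_topology X ?I) (\<lambda>(s, t). (g s, t))"
        unfolding case_prod_beta
        by (intro continuous_map_pairedI continuous_map_snd
            continuous_map_compose[OF continuous_map_fst g_cont, unfolded comp_def])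
      then show "continuous_map (prod_topology ?S ?I) X h"
        unfolding h_def using k(1) by (rule continuous_map_compose)
      have "(\<lambda>s. h (s, 1)) ` S = g ` S"
        using k(2) gX by (intro image_cong) (simp_all add: h_def)
      then show "uncountable ((\<lambda>s. h (s, 1)) ` S)"
        using assms(3) \<open>inj_on g S\<close> countable_image_inj_on by metis
      show "(\<lambda>s. h (s, 0)) constant_on S"
        using k(3) gX unfolding constant_on_def h_def by auto
    qed
  qed
  ultimately show ?thesis by blast
qed

end
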